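(* Consider a Totalitarian Tug-of-War with parameter $\epsilon>0$ played on a graph segment with nodes $x_0,x_1,\ldots,x_n,x_{n+1}$, where $x_1,\dots,x_n$ are the $n\geq 2$ running nodes. Let $F_0$ and $F_{n+1}$ be the terminal payoffs at $x_0$ and $x_{n+1}$ respectively, with $F_0\leq F_{n+1}$, and define $$Q=\frac{F_{n+1}-F_0}{\epsilon}\geq 0.$$ Let $u_i$ denote the value of the game started at $x_i$. Then the value of the game and strategies that realize it are described exhaustively in terms of $Q$ as follows. (a) If $Q>n+1$, then $$u_i=\left(\frac{n+1-i}{n+1}\right)F_0+\frac{i}{n+1}F_{n+1},\qquad 1\leq i\leq n.$$ In this case the value is realized when the players play a classical random Tug-of-War at every running node, Player I's strategy being to always move towards $x_{n+1}$ and Player II's strategy to always move towards $x_0$. (b) If $n-1<Q\leq n+1$, then $$u_i=F_0+i\,\epsilon,\qquad 1\leq i\leq n.$$ In this case the value is realized when Player I always lets Player II decide the next move, and Player II moves towards $x_0$. Moreover, if $Q=n+1$ there is a family of pairs of strategies that yield the same value of the game, which includes the pair just mentioned as a particular case: for each fixed integer $j\in[0,n]$, Player I lets Player II decide the next move at the nodes $x_i$ with $1\leq i\leq j$, who moves towards $x_0$; and the players play a classical random Tug-of-War at the nodes $x_i$ with $j+1\leq i\leq n$ (Players I and II moving towards $x_{n+1}$ and $x_0$ respectively). (c) If there exists an integer $k\in[1,n-1]$ such that $2k-n-1<Q\leq 2k-n+1$, then $$u_i=\begin{cases}F_0+i\,\epsilon, & 1\leq i\leq k,\\ F_{n+1}+(n+1-i)\,\epsilon,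 & k+1\leq i\leq n.\end{cases}$$ In this case the value is realized when Player I always lets Player II decide the next move, who moves towards $x_0$ at the nodes $x_i$ with $1\leq i\leq k$ and towards $x_{n+1}$ at the nodes $x_i$ with $k+1\leq i\leq n$. Moreover, if $Q=2k-n+1$ there is a family of pairs of strategies that yield the same value of the game, which includes the pair just mentioned as a particular case: for each fixed integer $j\in[0,k]$, - Player I lets Player II decide the next move at the nodes $x_i$ with $1\leq i\leq j$, who moves towards $x_0$; - the players play a classical random Tug-of-War at the nodes $x_i$ with $j+1\leq i\leq k$ (Players I and II moving towards $x_{n+1}$ and $x_0$ respectively); - Player I lets Player II decide the next move at the nodes $x_i$ with $k+1\leq i\leq n$, who moves towards $x_{n+1}$.
   Context: Graph segment: nodes $x_0,\dots,x_{n+1}$, with $x_i$ and $x_{i+1}$ adjacent for $0\le i\le n$ and no other edges; $x_0,x_{n+1}$ are terminal and $x_1,\dots,x_n$ are running nodes. Game. A token starts at some $x^0$ among the nodes. At each turn, with the token at a running node, Player I decides either (i) to play a round of classical random Tug-of-War: a fair coin is tossed and the winner of the toss moves the token to a neighbor of the current node of his/her choice; or (ii) to let (force) Player II choose the new position among the neighbors of the current node, in exchange for a fixed payoff $\epsilon$ to Player I. The game ends the first time $\tau$ that the token reaches a terminal node $x^\tau$; Player I then receives from Player II the payoff $F_\tau+k_\tau\epsilon$, where $F_\tau$ is the terminal payoff at $x^\tau$ and $k_\tau$ is the number of turns at which Player I chose option (ii). Player I maximizes, Player II minimizes. Strategies and value. The history up to stage $k$ is $H^k=(x^0,a^0,x^1,a^1,\dots,a^{k-1},x^k)$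 (positions $x^i$ and actions $a^i$ carried out by the player who moved from $x^i$). A (pure) strategy of a player is a sequence of mappings from histories to actions (for Player I: the choice between (i) and (ii), and the neighbor to move to if the toss is won; for Player II: the neighbor to move to if given the move). For strategies $S_I,S_{II}$ and starting node $x$, set $V^x_{S_I,S_{II}}(I)=V^x_{S_I,S_{II}}(II)=\mathbb{E}^x_{S_I,S_{II}}[F_\tau+k_\tau\epsilon]$ if the game ends almost surely, and otherwise $V^x_{S_I,S_{II}}(I)=-\infty$, $V^x_{S_I,S_{II}}(II)=+\infty$. The value of the game at $x$ is the common value of $\sup_{S_I}\inf_{S_{II}}V^x_{S_I,S_{II}}(I)$ and $\inf_{S_{II}}\sup_{S_I}V^x_{S_I,S_{II}}(II)$. A pair of strategies $(S_I,S_{II})$ realizes (yields) the value if $\mathbb{E}^{x_i}_{S_I,S_{II}}[F_\tau+k_\tau\epsilon]=u_i$ for all $1\le i\le n$. *)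

theory Defs
  imports "HOL-Probability.Probability"
begin

text \<open>
  Totalitarian Tug-of-War on a segment. The node \<open>x_i\<close> is represented by its index \<open>i\<close>,
  \<open>0 \<le> i \<le> n + 1\<close>.
\<close>

definition running :: "nat \<Rightarrow> nat set" where
  "running n = {1..n}"

definition neighbors :: "nat \<Rightarrow> nat \<Rightarrow> nat set" where
  "neighbors n i = {j. j \<le> n + 1 \<and> (j = i + 1 \<or> i = j + 1)}"

text \<open>
  \<open>Toss y\<close>: play a round of random Tug-of-War, moving to \<open>y\<close> if the toss is won.
  \<open>Force\<close>: let Player II choose the new position, for the payoff \<open>\<epsilon>\<close>.
\<close>

datatype choiceI = Toss nat | Force

text \<open>
  The action recorded in the history at a turn: who moved, and under which option.
  The destination is the position that follows the action in the history:
  \<open>Move (Move (Start x0) a0 x1) a1 x2\<close> is the history \<open>(x0, a0, x1, a1, x2)\<close>.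
\<close>

datatype action = I_Won | II_Won | II_Forced

datatype history = Start nat | Move history action nat

primrec current :: "history \<Rightarrow> nat" where
  "current (Start x) = x"
| "current (Move h a y) = y"

primrec num_forced :: "history \<Rightarrow> nat" where
  "num_forced (Start x) = 0"
| "num_forced (Move h a y) = num_forced h + (if a = II_Forced then 1 else 0)"

text \<open>
  Strategies are needed only at histories that end at a running node; they have the value
  \<open>undefined\<close> elsewhere. Sequences of mappings, one for each length of the history, are
  the same as mappings on histories of all lengths.
\<close>

definition running_histories :: "nat \<Rightarrow> history set" where
  "running_histories n = {h. current h \<in> running n}"

definition strategiesI :: "nat \<Rightarrow> (history \<Rightarrow> choiceI) set" where
  "strategiesI n = (\<Pi>\<^sub>E h\<in>running_histories n. insert Force (Toss ` neighbors n (current h)))"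

definition strategiesII :: "nat \<Rightarrow> (history \<Rightarrow> nat) set" where
  "strategiesII n = (\<Pi>\<^sub>E h\<in>running_histories n. neighbors n (current h))"

text \<open>
  The play from \<open>x\<close> as a function of a sequence of fair coins; Player I wins the toss of turn
  \<open>k\<close> iff \<open>\<omega> k\<close>, and this coin is ignored if Player I chooses \<open>Force\<close> at that turn.
\<close>

definition coins :: "(nat \<Rightarrow> bool) measure" where
  "coins = (\<Pi>\<^sub>M k\<in>UNIV. measure_pmf (bernoulli_pmf (1/2)))"

definition next_history ::
  "nat \<Rightarrow> (history \<Rightarrow> choiceI) \<Rightarrow> (history \<Rightarrow> nat) \<Rightarrow> bool \<Rightarrow> history \<Rightarrow> history" where
  "next_history n SI SII c h =
     (if current h \<in> running n then
        (case SI h of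
           Toss y \<Rightarrow> if c then Move h I_Won y else Move h II_Won (SII h)
         | Force \<Rightarrow> Move h II_Forced (SII h))
      else h)"

primrec play ::
  "nat \<Rightarrow> (history \<Rightarrow> choiceI) \<Rightarrow> (history \<Rightarrow> nat) \<Rightarrow> nat \<Rightarrow> (nat \<Rightarrow> bool) \<Rightarrow> nat \<Rightarrow> history" where
  "play n SI SII x \<omega> 0 = Start x"
| "play n SI SII x \<omega> (Suc k) = next_history n SI SII (\<omega> k) (play n SI SII x \<omega> k)"

definition ends_almost_surely ::
  "nat \<Rightarrow> (history \<Rightarrow> choiceI) \<Rightarrow> (history \<Rightarrow> nat) \<Rightarrow> nat \<Rightarrow> bool" where
  "ends_almost_surely n SI SII x \<longleftrightarrow>
     (AE \<omega> in coins. \<exists>k. current (play n SI SII x \<omega> k) \<notin> running n)"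

text \<open>Meaningful only if the play given by \<open>\<omega>\<close> ends. Only \<open>F 0\<close> and \<open>F (n + 1)\<close> matter.\<close>

definition payoff ::
  "nat \<Rightarrow> real \<Rightarrow> (nat \<Rightarrow> real) \<Rightarrow> (history \<Rightarrow> choiceI) \<Rightarrow> (history \<Rightarrow> nat) \<Rightarrow> nat \<Rightarrow>
   (nat \<Rightarrow> bool) \<Rightarrow> real" where
  "payoff n \<epsilon> F SI SII x \<omega> =
     (let \<tau> = (LEAST k. current (play n SI SII x \<omega> k) \<notin> running n);
          h = play n SI SII x \<omega> \<tau>
      in F (current h) + real (num_forced h) * \<epsilon>)"

text \<open>
  The expectation has to be extended-valued: the payoff is bounded below, but its
  expectation may be \<open>\<infinity>\<close> even if the game ends almost surely (the Bochner integral would be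
  \<open>0\<close> then). As usual it is the integral of the positive part minus that of the negative part;
  \<open>ennreal\<close> maps negative numbers to \<open>0\<close>.
\<close>

definition ext_expectation :: "'a measure \<Rightarrow> ('a \<Rightarrow> real) \<Rightarrow> ereal" where
  "ext_expectation M f =
     enn2ereal (\<integral>\<^sup>+ \<omega>. ennreal (f \<omega>) \<partial>M) - enn2ereal (\<integral>\<^sup>+ \<omega>. ennreal (- f \<omega>) \<partial>M)"

definition expected_payoff ::
  "nat \<Rightarrow> real \<Rightarrow> (nat \<Rightarrow> real) \<Rightarrow> (history \<Rightarrow> choiceI) \<Rightarrow> (history \<Rightarrow> nat) \<Rightarrow> nat \<Rightarrow> ereal" where
  "expected_payoff n \<epsilon> F SI SII x = ext_expectation coins (payoff n \<epsilon> F SI SII x)"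

definition V_I ::
  "nat \<Rightarrow> real \<Rightarrow> (nat \<Rightarrow> real) \<Rightarrow> (history \<Rightarrow> choiceI) \<Rightarrow> (history \<Rightarrow> nat) \<Rightarrow> nat \<Rightarrow> ereal" where
  "V_I n \<epsilon> F SI SII x =
     (if ends_almost_surely n SI SII x then expected_payoff n \<epsilon> F SI SII x else - \<infinity>)"

definition V_II ::
  "nat \<Rightarrow> real \<Rightarrow> (nat \<Rightarrow> real) \<Rightarrow> (history \<Rightarrow> choiceI) \<Rightarrow> (history \<Rightarrow> nat) \<Rightarrow> nat \<Rightarrow> ereal" where
  "V_II n \<epsilon> F SI SII x =
     (if ends_almost_surely n SI SII x then expected_payoff n \<epsilon> F SI SII x else \<infinity>)"

definition has_value :: "nat \<Rightarrow> real \<Rightarrow> (nat \<Rightarrow> real) \<Rightarrow> nat \<Rightarrow> ereal \<Rightarrow> bool" where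
  "has_value n \<epsilon> F x v \<longleftrightarrow>
     (SUP SI\<in>strategiesI n. INF SII\<in>strategiesII n. V_I n \<epsilon> F SI SII x) = v \<and>
     (INF SII\<in>strategiesII n. SUP SI\<in>strategiesI n. V_II n \<epsilon> F SI SII x) = v"

text \<open>
  A pair realizes the value if its expected payoff is the value of the game at every running
  node. This does not ask the two strategies to be optimal against other opponents. For the
  expected payoff to make sense, the game has to end almost surely.
\<close>

definition realizes_value ::
  "nat \<Rightarrow> real \<Rightarrow> (nat \<Rightarrow> real) \<Rightarrow> (history \<Rightarrow> choiceI) \<Rightarrow> (history \<Rightarrow> nat) \<Rightarrow> bool" where
  "realizes_value n \<epsilon> F SI SII \<longleftrightarrow>
     SI \<in> strategiesI n \<and> SII \<in> strategiesII n \<and>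
     (\<forall>i\<in>running n. ends_almost_surely n SI SII i \<and>
        has_value n \<epsilon> F i (expected_payoff n \<epsilon> F SI SII i))"

text \<open>The strategy that plays \<open>f i\<close> whenever the token is at the running node \<open>i\<close>.\<close>

definition positional :: "nat \<Rightarrow> (nat \<Rightarrow> 'a) \<Rightarrow> history \<Rightarrow> 'a" where
  "positional n f = (\<lambda>h\<in>running_histories n. f (current h))"

text \<open>
  Moving towards \<open>x_0\<close> or \<open>x_{n+1}\<close> from \<open>x_i\<close> means moving to \<open>i - 1\<close> or \<open>i + 1\<close>.
  In \<open>toss_right_on n A\<close>, Player I plays random Tug-of-War, moving towards \<open>x_{n+1}\<close>, at the
  nodes in \<open>A\<close>, and lets Player II decide elsewhere. In \<open>move_left_on n A\<close>, Player II moves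
  towards \<open>x_0\<close> at the nodes in \<open>A\<close>, and towards \<open>x_{n+1}\<close> elsewhere.
\<close>

definition toss_right_on :: "nat \<Rightarrow> nat set \<Rightarrow> history \<Rightarrow> choiceI" where
  "toss_right_on n A = positional n (\<lambda>i. if i \<in> A then Toss (i + 1) else Force)"

definition move_left_on :: "nat \<Rightarrow> nat set \<Rightarrow> history \<Rightarrow> nat" where
  "move_left_on n A = positional n (\<lambda>i. if i \<in> A then i - 1 else i + 1)"

end

theory Submission
  imports Defs
begin

text \<open>
  Let \<open>u\<close> be the claimed value and follow \<open>M = u (position) + \<epsilon> \<cdot> (number of forced turns)\<close>
  along a play. If Player II moves as described, \<open>M\<close> is a supermartingale bounded below, so
  Fatou's lemma bounds the expected payoff by \<open>u\<close>. Player I secures \<open>u\<close> in case (a) by tossing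
  at every node, since \<open>u\<close> is linear. In cases (b) and (c), which are the same with \<open>k = n\<close> in (b),
  Player I forces until the collected payments alone exceed \<open>u\<close> and then tosses until the game
  ends: \<open>M\<close> never decreases along the forced turns, so the payoff is at least \<open>u\<close> on every
  play that ends. For the pairs in the statement, \<open>M\<close> is a bounded martingale.
\<close>

section \<open>The coin space and its symmetry under flipping one coin\<close>

instance action :: countable
  by countable_datatype

text \<open>Makes a map that depends on the previous history measurable as soon as it is so for each
  fixed history.\<close>

instance history :: countable
  by countable_datatype

lemma prob_space_coins: "prob_space coins"
  unfolding coins_def by (rule prob_space_PiM) (rule prob_space_measure_pmf)

interpretation coins: prob_space coins
  by (rule prob_space_coins)

lemma space_coins [simp]: "space coins = UNIV"
  by (simp add: coins_def space_PiM)

lemma measurable_coin [measurable]: "(\<lambda>\<omega>. \<omega> k) \<in> measurable coins (count_space UNIV)"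
proof -
  have "(\<lambda>\<omega>. \<omega> k) \<in> measurable coins (measure_pmf (bernoulli_pmf (1/2)))"
    unfolding coins_def by (rule measurable_component_singleton) simp
  then show ?thesis
    by (simp cong: measurable_cong_sets)
qed

lemma measurable_flip_coin [measurable]:
  "(\<lambda>\<omega>. fun_upd \<omega> k (\<not> \<omega> k)) \<in> measurable coins coins"
proof -
  have "(\<lambda>\<omega>. fun_upd \<omega> k (\<not> \<omega> k)) \<in> measurable coins (\<Pi>\<^sub>M k\<in>UNIV. measure_pmf (bernoulli_pmf (1/2)))"
  proof (rule measurable_PiM_single')
    fix i :: nat
    have "(\<lambda>\<omega>. (fun_upd \<omega> k (\<not> \<omega> k)) i) \<in> measurable coins (count_space UNIV)"
      by (cases "i = k") simp_all
    then show "(\<lambda>\<omega>. (fun_upd \<omega> k (\<not> \<omega> k)) i) \<in> measurable coins (measure_pmf (bernoulli_pmf (1/2)))"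
      by (simp cong: measurable_cong_sets)
  qed simp
  then show ?thesis
    by (simp add: coins_def)
qed

text \<open>Measures on the product are determined by cylinders over finitely many coordinates. The
  flip turns such a cylinder into one whose condition at \<open>k\<close> is replaced by its
  preimage under negation, and a fair coin gives both conditions the same mass.\<close>

lemma distr_flip_coin: "distr coins coins (\<lambda>\<omega>. fun_upd \<omega> k (\<not> \<omega> k)) = coins"
proof -
  let ?p = "\<lambda>_::nat. measure_pmf (bernoulli_pmf (1/2))"
  interpret P: product_prob_space ?p UNIV
    by (simp add: product_prob_space_def product_sigma_finite_def product_prob_space_axioms_def
        measure_pmf.sigma_finite_measure_axioms measure_pmf.prob_space_axioms)
  have "distr coins coins (\<lambda>\<omega>. fun_upd \<omega> k (\<not> \<omega> k)) = PiM UNIV ?p"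
  proof (rule P.PiM_eq)
    show "sets (distr coins coins (\<lambda>\<omega>. fun_upd \<omega> k (\<not> \<omega> k))) = sets (PiM UNIV ?p)"
      by (simp add: coins_def)
  next
    fix J :: "nat set" and A
    assume J: "finite J"
    let ?A = "A(k := Not -` A k)"
    have E: "prod_emb UNIV ?p J (Pi\<^sub>E J B) \<in> sets coins" for B
      unfolding coins_def using J by (intro sets_PiM_I) auto
    have "(\<lambda>\<omega>. fun_upd \<omega> k (\<not> \<omega> k)) -` prod_emb UNIV ?p J (Pi\<^sub>E J A) = prod_emb UNIV ?p J (Pi\<^sub>E J ?A)"
      by (auto simp: prod_emb_def PiE_iff extensional_def restrict_def split: if_splits)
    then have "emeasure (distr coins coins (\<lambda>\<omega>. fun_upd \<omega> k (\<not> \<omega> k))) (prod_emb UNIV ?p J (Pi\<^sub>E J A)) =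
        emeasure (PiM UNIV ?p) (prod_emb UNIV ?p J (Pi\<^sub>E J ?A))"
      using E by (simp add: emeasure_distr) (simp add: coins_def)
    also have "\<dots> = (\<Prod>j\<in>J. emeasure (?p j) (?A j))"
      using J by (intro P.emeasure_PiM_emb) auto
    also have "\<dots> = (\<Prod>j\<in>J. emeasure (?p j) (A j))"
    proof (rule prod.cong [OF refl])
      fix j
      have "map_pmf Not (bernoulli_pmf (1/2)) = bernoulli_pmf (1/2)"
      proof (rule pmf_eqI)
        fix b
        \<comment> \<open>Writing \<open>b\<close> as a double negation exhibits it as a value of
          the injective map \<open>Not\<close>.\<close>
        have "pmf (map_pmf Not (bernoulli_pmf (1/2))) (Not (\<not> b)) = pmf (bernoulli_pmf (1/2)) (\<not> b)"
          by (rule pmf_map_inj') (auto intro: injI)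
        then show "pmf (map_pmf Not (bernoulli_pmf (1/2))) b = pmf (bernoulli_pmf (1/2)) b"
          by (cases b) simp_all
      qed
      then have "emeasure (bernoulli_pmf (1/2)) (Not -` A k) = emeasure (bernoulli_pmf (1/2)) (A k)"
        by (metis emeasure_map_pmf)
      then show "emeasure (?p j) (?A j) = emeasure (?p j) (A j)"
        by simp
    qed
    finally show "emeasure (distr coins coins (\<lambda>\<omega>. fun_upd \<omega> k (\<not> \<omega> k)))
        (prod_emb UNIV ?p J (Pi\<^sub>E J A)) = (\<Prod>j\<in>J. emeasure (?p j) (A j))" .
  qed
  then show ?thesis
    by (simp add: coins_def)
qed

section \<open>Plays as random variables, and one turn in expectation\<close>

lemma play_cong:
  assumes "\<And>i. i < k \<Longrightarrow> \<omega> i = \<omega>' i"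
  shows "play n SI SII x \<omega> k = play n SI SII x \<omega>' k"
  using assms by (induction k) simp_all

lemma measurable_play [measurable]:
  "(\<lambda>\<omega>. play n SI SII x \<omega> k) \<in> measurable coins (count_space UNIV)"
proof (induction k)
  case (Suc k)
  have "(\<lambda>\<omega>. next_history n SI SII (\<omega> k) h) \<in> measurable coins (count_space UNIV)" for h
    by (rule measurable_compose [OF measurable_coin]) simp
  then show ?case
    using Suc by (simp add: measurable_compose_countable)
qed simp

text \<open>Given the strategies, each turn has at most two outcomes. Hence every real function of
  the history after a fixed number of turns is bounded, and so integrable.\<close>

lemma finite_range_play: "finite (range (\<lambda>\<omega>. play n SI SII x \<omega> k))"
proof (induction k)
  case (Suc k)
  have "range (\<lambda>\<omega>. play n SI SII x \<omega> (Suc k)) \<subseteq>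
      (\<lambda>(c, h). next_history n SI SII c h) ` (UNIV \<times> range (\<lambda>\<omega>. play n SI SII x \<omega> k))"
    by auto
  then show ?case
    by (rule finite_subset) (use Suc in auto)
qed simp

lemma integrable_play [simp]:
  fixes g :: "history \<Rightarrow> real"
  shows "integrable coins (\<lambda>\<omega>. g (play n SI SII x \<omega> k))"
proof -
  have "norm (g (play n SI SII x \<omega> k)) \<le> Max ((\<lambda>h. norm (g h)) ` range (\<lambda>\<omega>. play n SI SII x \<omega> k))" for \<omega>
    by (rule Max_ge [OF finite_imageI [OF finite_range_play]]) simp
  then show ?thesis
    by (intro coins.integrable_const_bound) (auto intro: AE_I2)
qed

text \<open>
  Flipping coin \<open>k\<close> preserves the measure and does not affect the first \<open>k\<close> turns; averaging
  over the flip replaces an argument by independence.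
\<close>

lemma integral_play_Suc:
  fixes g :: "history \<Rightarrow> real" and n SI SII x k
  defines "m \<equiv> (\<lambda>h. (g (next_history n SI SII True h) + g (next_history n SI SII False h)) / 2)"
  shows "(\<integral>\<omega>. g (play n SI SII x \<omega> (Suc k)) \<partial>coins) = (\<integral>\<omega>. m (play n SI SII x \<omega> k) \<partial>coins)"
proof -
  let ?flip = "\<lambda>\<omega> :: nat \<Rightarrow> bool. fun_upd \<omega> k (\<not> \<omega> k)"
  let ?g = "\<lambda>\<omega>. g (play n SI SII x \<omega> (Suc k))"
  have flip: "integrable coins (\<lambda>\<omega>. ?g (?flip \<omega>))"
    "(\<integral>\<omega>. ?g (?flip \<omega>) \<partial>coins) = (\<integral>\<omega>. ?g \<omega> \<partial>coins)"
    using integrable_distr [of ?flip coins coins ?g] integral_distr [of ?flip coins coins ?g]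
    by (simp_all only: distr_flip_coin measurable_flip_coin integrable_play)
       (simp_all add: borel_measurable_integrable)
  \<comment> \<open>The sequence and its flip share the first \<open>k\<close> turns and show both
    results of coin \<open>k\<close> between them, so the mean over the coin is a mean over the two
    sequences.\<close>
  have m: "m (play n SI SII x \<omega> k) = (?g \<omega> + ?g (?flip \<omega>)) / 2" for \<omega>
  proof -
    have "play n SI SII x (?flip \<omega>) k = play n SI SII x \<omega> k"
      by (rule play_cong) simp
    then show ?thesis
      by (cases "\<omega> k") (simp_all add: m_def add.commute)
  qed
  have "(\<integral>\<omega>. m (play n SI SII x \<omega> k) \<partial>coins) =
      ((\<integral>\<omega>. ?g \<omega> \<partial>coins) + (\<integral>\<omega>. ?g (?flip \<omega>) \<partial>coins)) / 2"
    unfolding m using flip(1) integrable_play [of g n SI SII x "Suc k"]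
    by (simp only: integral_divide_zero Bochner_Integration.integral_add)
  then show ?thesis
    by (simp add: flip(2) del: play.simps)
qed

section \<open>Super- and submartingales along a play\<close>

lemma next_history_stopped [simp]:
  "current h \<notin> running n \<Longrightarrow> next_history n SI SII c h = h"
  by (simp add: next_history_def)

lemma play_stopped:
  assumes "current (play n SI SII x \<omega> k) \<notin> running n" and "k \<le> m"
  shows "play n SI SII x \<omega> m = play n SI SII x \<omega> k"
  using assms(2,1) by (induction m rule: dec_induct) simp_all

text \<open>A finished history is a fixed point of \<open>next_history\<close>, so there the
  one-turn inequality is an equality; at running nodes it is the hypothesis, cleared of its
  denominator 2.\<close>

lemma supermartingale_play:
  fixes g :: "history \<Rightarrow> real"
  assumes "\<And>h. current h \<in> running n \<Longrightarrow>
    g (next_history n SI SII True h) + g (next_history n SI SII False h) \<le> 2 * g h"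
  shows "(\<integral>\<omega>. g (play n SI SII x \<omega> k) \<partial>coins) \<le> g (Start x)"
proof (induction k)
  case (Suc k)
  have "(g (next_history n SI SII True h) + g (next_history n SI SII False h)) / 2 \<le> g h" for h
    using assms [of h] by (cases "current h \<in> running n") simp_all
  then have "(\<integral>\<omega>. g (play n SI SII x \<omega> (Suc k)) \<partial>coins) \<le> (\<integral>\<omega>. g (play n SI SII x \<omega> k) \<partial>coins)"
    unfolding integral_play_Suc by (intro integral_mono integrable_play)
  with Suc show ?case
    by linarith
qed (simp add: coins.prob_space [unfolded space_coins])

lemma submartingale_play:
  fixes g :: "history \<Rightarrow> real"
  assumes "\<And>h. current h \<in> running n \<Longrightarrow>
    g (next_history n SI SII True h) + g (next_history n SI SII False h) \<ge> 2 * g h"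
  shows "(\<integral>\<omega>. g (play n SI SII x \<omega> k) \<partial>coins) \<ge> g (Start x)"
proof -
  have "(\<integral>\<omega>. - g (play n SI SII x \<omega> k) \<partial>coins) \<le> - g (Start x)"
  proof (rule supermartingale_play)
    show "- g (next_history n SI SII True h) + - g (next_history n SI SII False h) \<le> 2 * - g h"
      if "current h \<in> running n" for h
      using assms [OF that] by simp
  qed
  then show ?thesis
    by simp
qed

section \<open>Almost sure termination from a potential with drift\<close>

text \<open>A clock that can be read off the history, so that \<open>supermartingale_play\<close>,
  whose \<open>g\<close> sees only the history, applies to a potential with a time term. It agrees
  with the stage while the game is running and stops with it.\<close>

primrec turns :: "history \<Rightarrow> nat" where
  "turns (Start x) = 0"
| "turns (Move h a y) = Suc (turns h)"

lemma turns_next_history: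
  "current h \<in> running n \<Longrightarrow> turns (next_history n SI SII c h) = Suc (turns h)"
  by (simp add: next_history_def split: choiceI.split)

lemma turns_play:
  "current (play n SI SII x \<omega> k) \<in> running n \<Longrightarrow> turns (play n SI SII x \<omega> k) = k"
proof (induction k)
  case (Suc k)
  then have "current (play n SI SII x \<omega> k) \<in> running n"
    by (metis next_history_stopped play.simps(2))
  with Suc.IH show ?case
    by (simp add: turns_next_history)
qed simp

text \<open>
  Adding \<open>\<delta>\<close> per turn to \<open>\<phi>\<close> still gives a supermartingale, so by Markov's inequality the play
  lasts more than \<open>k\<close> turns with probability at most \<open>\<phi> (Start x) / (\<delta> k)\<close>.
\<close>

lemma ends_almost_surely_drift:
  fixes \<phi> :: "history \<Rightarrow> real"
  assumes "\<delta> > 0" and nonneg: "\<And>h. \<phi> h \<ge> 0"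
    and drift: "\<And>h. current h \<in> running n \<Longrightarrow>
      \<phi> (next_history n SI SII True h) + \<phi> (next_history n SI SII False h) \<le> 2 * (\<phi> h - \<delta>)"
  shows "ends_almost_surely n SI SII x"
proof -
  define R where "R k = {\<omega>. current (play n SI SII x \<omega> k) \<in> running n}" for k
  define N where "N = {\<omega>. \<forall>k. current (play n SI SII x \<omega> k) \<in> running n}"
  have R [measurable]: "R k \<in> sets coins" for k
  proof -
    have "{\<omega> \<in> space coins. current (play n SI SII x \<omega> k) \<in> running n} \<in> sets coins"
      by measurable
    then show ?thesis
      by (simp add: R_def)
  qed
  have N_eq: "N = (\<Inter>k. R k)"
    by (auto simp: N_def R_def)
  then have N: "N \<in> sets coins"
    by auto
  have "coins.prob N \<le> \<phi> (Start x) / (\<delta> * real (Suc k))" for k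
  proof -
    \<comment> \<open>The successor keeps the divisor positive and matches the null sequence
      \<open>inverse (real (Suc k))\<close> used below.\<close>
    let ?k = "Suc k"
    let ?g = "\<lambda>h. \<phi> h + \<delta> * real (turns h)"
    have "\<delta> * real ?k * coins.prob N \<le> \<delta> * real ?k * coins.prob (R ?k)"
      using \<open>\<delta> > 0\<close> N_eq by (intro mult_left_mono coins.finite_measure_mono R) auto
    also have "\<dots> = (\<integral>\<omega>. \<delta> * real ?k * indicator (R ?k) \<omega> \<partial>coins)"
      by simp
    also have "\<dots> \<le> (\<integral>\<omega>. ?g (play n SI SII x \<omega> ?k) \<partial>coins)"
    proof (rule integral_mono)
      show "integrable coins (\<lambda>\<omega>. ?g (play n SI SII x \<omega> ?k))"
        by (rule integrable_play)
      show "\<delta> * real ?k * indicator (R ?k) \<omega> \<le> ?g (play n SI SII x \<omega> ?k)" for \<omega>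
      proof (cases "\<omega> \<in> R ?k")
        case True
        then have "turns (play n SI SII x \<omega> ?k) = ?k"
          unfolding R_def by (intro turns_play) simp
        then show ?thesis
          using True nonneg by (simp del: play.simps)
      next
        case False
        then show ?thesis
          using nonneg \<open>\<delta> > 0\<close> by (simp add: add_nonneg_nonneg del: play.simps)
      qed
    qed (simp add: coins.emeasure_eq_measure)
    also have "\<dots> \<le> ?g (Start x)"
    proof (rule supermartingale_play)
      fix h
      assume h: "current h \<in> running n"
      show "?g (next_history n SI SII True h) + ?g (next_history n SI SII False h) \<le> 2 * ?g h"
        using drift [OF h] by (simp add: turns_next_history [OF h] algebra_simps)
    qed
    finally show ?thesis
      using \<open>\<delta> > 0\<close> by (subst pos_le_divide_eq) (simp_all add: mult.commute)
  qed
  moreover have "(\<lambda>k. \<phi> (Start x) / (\<delta> * real (Suc k))) \<longlonglongrightarrow> 0"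
  proof -
    have "\<phi> (Start x) / (\<delta> * r) = \<phi> (Start x) / \<delta> * inverse r" for r
      by (simp add: divide_inverse)
    then show ?thesis
      by (simp only: tendsto_mult_right_zero [OF LIMSEQ_inverse_real_of_nat])
  qed
  ultimately have "coins.prob N \<le> 0"
    by (intro LIMSEQ_le_const) auto
  then have "N \<in> null_sets coins"
    using N by (auto simp: null_sets_def coins.emeasure_eq_measure antisym)
  then have "AE \<omega> in coins. \<omega> \<notin> N"
    by (rule AE_not_in)
  then show ?thesis
    by (simp add: ends_almost_surely_def N_def)
qed

section \<open>The payoff as the final value of a play\<close>

text \<open>Once the play ends its history is frozen, so every late enough stage shows the payoff.
  In this form the limit arguments avoid the \<open>LEAST\<close> in \<open>payoff\<close>.\<close>

lemma payoff_eventually: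
  assumes "\<exists>k. current (play n SI SII x \<omega> k) \<notin> running n"
  shows "\<forall>\<^sub>F k in sequentially. current (play n SI SII x \<omega> k) \<notin> running n \<and>
    payoff n \<epsilon> F SI SII x \<omega> =
      F (current (play n SI SII x \<omega> k)) + real (num_forced (play n SI SII x \<omega> k)) * \<epsilon>"
proof -
  define \<tau> where "\<tau> = (LEAST k. current (play n SI SII x \<omega> k) \<notin> running n)"
  have \<tau>: "current (play n SI SII x \<omega> \<tau>) \<notin> running n"
    unfolding \<tau>_def using assms by (rule LeastI_ex)
  have payoff: "payoff n \<epsilon> F SI SII x \<omega> =
      F (current (play n SI SII x \<omega> \<tau>)) + real (num_forced (play n SI SII x \<omega> \<tau>)) * \<epsilon>"
    by (simp add: payoff_def Let_def \<tau>_def)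
  show ?thesis
    using eventually_ge_at_top [of \<tau>]
  proof eventually_elim
    case (elim k)
    with \<tau> payoff show ?case
      by (simp only: play_stopped [OF \<tau> elim] simp_thms)
  qed
qed

lemma measurable_payoff [measurable]: "payoff n \<epsilon> F SI SII x \<in> borel_measurable coins"
proof -
  have [measurable]: "(\<lambda>\<omega>. LEAST k. current (play n SI SII x \<omega> k) \<notin> running n) \<in>
      measurable coins (count_space UNIV)"
    by (rule measurable_Least) measurable
  have [measurable]: "(\<lambda>\<omega>. play n SI SII x \<omega> (LEAST k. current (play n SI SII x \<omega> k) \<notin> running n)) \<in>
      measurable coins (count_space UNIV)"
    by (rule measurable_compose_countable [where f = "\<lambda>k \<omega>. play n SI SII x \<omega> k"]) measurable
  show ?thesis
    unfolding payoff_def Let_def by measurable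
qed

section \<open>Limits under the extended expectation\<close>

lemma ext_expectation_integrable:
  "integrable M f \<Longrightarrow> ext_expectation M f = ereal (integral\<^sup>L M f)"
  unfolding ext_expectation_def
  by (erule integrableE) simp

lemma ext_expectation_mono_AE:
  assumes "AE x in M. f x \<le> g x"
  shows "ext_expectation M f \<le> ext_expectation M g"
proof -
  have "(\<integral>\<^sup>+ x. ennreal (f x) \<partial>M) \<le> (\<integral>\<^sup>+ x. ennreal (g x) \<partial>M)"
    using assms by (intro nn_integral_mono_AE) (auto elim!: eventually_mono intro: ennreal_leI)
  moreover have "(\<integral>\<^sup>+ x. ennreal (- g x) \<partial>M) \<le> (\<integral>\<^sup>+ x. ennreal (- f x) \<partial>M)"
    using assms by (intro nn_integral_mono_AE) (auto elim!: eventually_mono intro: ennreal_leI)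
  ultimately show ?thesis
    unfolding ext_expectation_def less_eq_ennreal.rep_eq by (rule ereal_minus_mono)
qed

lemma (in prob_space) ext_expectation_ge_const:
  "AE x in M. v \<le> f x \<Longrightarrow> ereal v \<le> ext_expectation M f"
  using ext_expectation_mono_AE [where M = M and f = "\<lambda>_. v" and g = f]
  by (simp add: ext_expectation_integrable prob_space)

text \<open>Fatou's lemma for the nonnegative functions \<open>f k - c\<close>. As the bound on the
  expectations is finite, \<open>g\<close> is in fact integrable and its extended expectation is an
  ordinary integral.\<close>

lemma (in prob_space) ext_expectation_le_limit:
  fixes f :: "nat \<Rightarrow> 'a \<Rightarrow> real"
  assumes f: "\<And>k. integrable M (f k)" and [measurable]: "g \<in> borel_measurable M"
    and lim: "AE x in M. (\<lambda>k. f k x) \<longlonglongrightarrow> g x"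
    and bound: "\<And>k x. x \<in> space M \<Longrightarrow> c \<le> f k x"
    and le: "\<And>k. expectation (f k) \<le> v"
  shows "ext_expectation M g \<le> ereal v"
proof -
  have [measurable]: "f k \<in> borel_measurable M" for k
    using f by simp
  have ge: "AE x in M. 0 \<le> g x - c"
    using lim AE_space
  proof eventually_elim
    case (elim x)
    have "c \<le> g x"
      using elim bound by (intro LIMSEQ_le_const [of "\<lambda>k. f k x"]) auto
    then show ?case
      by simp
  qed
  have "(\<integral>\<^sup>+ x. ennreal (g x - c) \<partial>M) = (\<integral>\<^sup>+ x. liminf (\<lambda>k. ennreal (f k x - c)) \<partial>M)"
  proof (rule nn_integral_cong_AE)
    show "AE x in M. ennreal (g x - c) = liminf (\<lambda>k. ennreal (f k x - c))"
      using lim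
    proof eventually_elim
      case (elim x)
      then have "(\<lambda>k. ennreal (f k x - c)) \<longlonglongrightarrow> ennreal (g x - c)"
        by (intro tendsto_ennrealI tendsto_diff tendsto_const)
      then show ?case
        by (simp add: lim_imp_Liminf)
    qed
  qed
  also have "\<dots> \<le> liminf (\<lambda>k. \<integral>\<^sup>+ x. ennreal (f k x - c) \<partial>M)"
    by (rule nn_integral_liminf) measurable
  also have "\<dots> \<le> liminf (\<lambda>_::nat. ennreal (v - c))"
  proof (rule Liminf_mono, rule always_eventually, rule allI)
    fix k
    have "(\<integral>\<^sup>+ x. ennreal (f k x - c) \<partial>M) = ennreal (expectation (\<lambda>x. f k x - c))"
      using f bound by (intro nn_integral_eq_integral) auto
    also have "\<dots> \<le> ennreal (v - c)"
      using le [of k] f by (intro ennreal_leI) (simp add: prob_space)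
    finally show "(\<integral>\<^sup>+ x. ennreal (f k x - c) \<partial>M) \<le> ennreal (v - c)" .
  qed
  finally have le_v: "(\<integral>\<^sup>+ x. ennreal (g x - c) \<partial>M) \<le> ennreal (v - c)"
    by (simp add: Liminf_const)
  then have int: "integrable M (\<lambda>x. g x - c)"
    using ge by (intro integrableI_nonneg) (simp_all add: le_less_trans [OF le_v])
  then have "integrable M (\<lambda>x. (g x - c) + c)"
    by (intro Bochner_Integration.integrable_add) simp_all
  then have g: "integrable M g"
    by simp
  \<comment> \<open>\<open>ennreal\<close> sends negative numbers to 0, so the bound
    \<open>ennreal (v - c)\<close> speaks of \<open>v - c\<close> itself only once this difference
    is known to be nonnegative.\<close>
  have "c \<le> v"
  proof -
    have "c = expectation (\<lambda>_. c)"
      by (simp add: prob_space)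
    also have "\<dots> \<le> expectation (f 0)"
      using f bound by (intro integral_mono) auto
    also have "\<dots> \<le> v"
      by (rule le)
    finally show ?thesis .
  qed
  then have "expectation (\<lambda>x. g x - c) \<le> v - c"
    using le_v ge by (simp add: nn_integral_eq_integral [OF int])
  then show ?thesis
    using g by (simp add: ext_expectation_integrable prob_space)
qed

text \<open>Fatou's lemma under a lower bound yields the opposite inequality; here a uniform
  two-sided bound gives convergence of the expectations by domination.\<close>

lemma (in prob_space) ext_expectation_ge_limit:
  fixes f :: "nat \<Rightarrow> 'a \<Rightarrow> real"
  assumes [measurable]: "\<And>k. f k \<in> borel_measurable M" "g \<in> borel_measurable M"
    and lim: "AE x in M. (\<lambda>k. f k x) \<longlonglongrightarrow> g x"
    and bound: "\<And>k x. x \<in> space M \<Longrightarrow> \<bar>f k x\<bar> \<le> c"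
    and le: "\<And>k. v \<le> expectation (f k)"
  shows "ereal v \<le> ext_expectation M g"
proof -
  have b: "AE x in M. norm (f k x) \<le> c" for k
    using bound by (auto intro: AE_I2)
  have "integrable M g"
    by (rule integrable_dominated_convergence [OF _ _ _ lim b]) simp_all
  moreover have "(\<lambda>k. expectation (f k)) \<longlonglongrightarrow> expectation g"
    by (rule integral_dominated_convergence [OF _ _ _ lim b]) simp_all
  then have "v \<le> expectation g"
    using le by (intro LIMSEQ_le_const) auto
  ultimately show ?thesis
    by (simp add: ext_expectation_integrable)
qed

section \<open>The score of a candidate value\<close>

lemma current_play_le:
  assumes SI: "SI \<in> strategiesI n" and SII: "SII \<in> strategiesII n" and "x \<le> n + 1"
  shows "current (play n SI SII x \<omega> k) \<le> n + 1"
proof (induction k)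
  case (Suc k)
  let ?h = "play n SI SII x \<omega> k"
  show ?case
  proof (cases "current ?h \<in> running n")
    case True
    then have "?h \<in> running_histories n"
      by (simp add: running_histories_def)
    then have "SI ?h \<in> insert Force (Toss ` neighbors n (current ?h))" "SII ?h \<in> neighbors n (current ?h)"
      using PiE_mem [OF SI [unfolded strategiesI_def]] PiE_mem [OF SII [unfolded strategiesII_def]]
      by simp_all
    then show ?thesis
      using True by (auto simp: next_history_def neighbors_def)
  qed (use Suc in simp)
qed (use assms in simp)

lemma stopped_at_terminal: "i \<le> n + 1 \<Longrightarrow> i \<notin> running n \<Longrightarrow> i = 0 \<or> i = n + 1"
  by (auto simp: running_def)

text \<open>The process \<open>M\<close> of the overview as a function of the history, for an
  arbitrary candidate \<open>u\<close>.\<close>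

definition score :: "real \<Rightarrow> (nat \<Rightarrow> real) \<Rightarrow> history \<Rightarrow> real" where
  "score \<epsilon> u h = u (current h) + real (num_forced h) * \<epsilon>"

lemma score_Start [simp]: "score \<epsilon> u (Start x) = u x"
  by (simp add: score_def)

lemma score_eventually_payoff:
  assumes "SI \<in> strategiesI n" and "SII \<in> strategiesII n" and "x \<le> n + 1"
    and "u 0 = F 0" and "u (n + 1) = F (n + 1)"
    and ends: "\<exists>k. current (play n SI SII x \<omega> k) \<notin> running n"
  shows "\<forall>\<^sub>F k in sequentially. score \<epsilon> u (play n SI SII x \<omega> k) = payoff n \<epsilon> F SI SII x \<omega>"
  using payoff_eventually [OF ends, of \<epsilon> F]
proof eventually_elim
  case (elim k)
  then have "current (play n SI SII x \<omega> k) = 0 \<or> current (play n SI SII x \<omega> k) = n + 1"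
    using current_play_le [OF assms(1-3)] by (intro stopped_at_terminal) auto
  then show ?case
    using elim assms(4,5) by (auto simp: score_def)
qed

lemma score_tendsto_payoff:
  assumes "SI \<in> strategiesI n" and "SII \<in> strategiesII n" and "x \<le> n + 1"
    and "u 0 = F 0" and "u (n + 1) = F (n + 1)"
    and "ends_almost_surely n SI SII x"
  shows "AE \<omega> in coins. (\<lambda>k. score \<epsilon> u (play n SI SII x \<omega> k)) \<longlonglongrightarrow> payoff n \<epsilon> F SI SII x \<omega>"
  using assms(6) unfolding ends_almost_surely_def
proof eventually_elim
  case (elim \<omega>)
  show ?case
    by (rule tendsto_eventually [OF score_eventually_payoff [OF assms(1-5) elim]])
qed

text \<open>The score is bounded below, as Fatou's lemma requires: the token stays on the finite
  segment and payments are nonnegative. Payments may accumulate without limit, so no upper bound is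
  at hand.\<close>

lemma expected_payoff_le:
  assumes "\<epsilon> \<ge> 0" and strategies: "SI \<in> strategiesI n" "SII \<in> strategiesII n" "x \<le> n + 1"
    and boundary: "u 0 = F 0" "u (n + 1) = F (n + 1)"
    and ends: "ends_almost_surely n SI SII x"
    and step: "\<And>h. current h \<in> running n \<Longrightarrow>
      score \<epsilon> u (next_history n SI SII True h) + score \<epsilon> u (next_history n SI SII False h)
        \<le> 2 * score \<epsilon> u h"
  shows "expected_payoff n \<epsilon> F SI SII x \<le> ereal (u x)"
  unfolding expected_payoff_def
proof (rule coins.ext_expectation_le_limit)
  show "AE \<omega> in coins. (\<lambda>k. score \<epsilon> u (play n SI SII x \<omega> k)) \<longlonglongrightarrow> payoff n \<epsilon> F SI SII x \<omega>"
    by (rule score_tendsto_payoff [OF strategies boundary ends])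
  show "Min (u ` {..n + 1}) \<le> score \<epsilon> u (play n SI SII x \<omega> k)" for \<omega> k
  proof -
    have "Min (u ` {..n + 1}) \<le> u (current (play n SI SII x \<omega> k))"
      using current_play_le [OF strategies] by (intro Min_le) auto
    then show ?thesis
      using \<open>\<epsilon> \<ge> 0\<close> by (simp add: score_def add_increasing2)
  qed
  show "(\<integral>\<omega>. score \<epsilon> u (play n SI SII x \<omega> k) \<partial>coins) \<le> u x" for k
    using supermartingale_play [where g = "score \<epsilon> u", OF step] by simp
qed simp_all

text \<open>Accumulated payments could make the score unbounded above, so an upper bound is assumed
  and has to be checked for the strategies at hand. The lower bound is as in
  \<open>expected_payoff_le\<close>.\<close>

lemma expected_payoff_ge:
  assumes "\<epsilon> \<ge> 0" and strategies: "SI \<in> strategiesI n" "SII \<in> strategiesII n" "x \<le> n + 1"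
    and boundary: "u 0 = F 0" "u (n + 1) = F (n + 1)"
    and ends: "ends_almost_surely n SI SII x"
    and step: "\<And>h. current h \<in> running n \<Longrightarrow>
      score \<epsilon> u (next_history n SI SII True h) + score \<epsilon> u (next_history n SI SII False h)
        \<ge> 2 * score \<epsilon> u h"
    and bound: "\<And>\<omega> k. score \<epsilon> u (play n SI SII x \<omega> k) \<le> Max (u ` {..n + 1})"
  shows "expected_payoff n \<epsilon> F SI SII x \<ge> ereal (u x)"
  unfolding expected_payoff_def
proof (rule coins.ext_expectation_ge_limit)
  show "(\<lambda>\<omega>. score \<epsilon> u (play n SI SII x \<omega> k)) \<in> borel_measurable coins" for k
    by (rule borel_measurable_integrable) (rule integrable_play)
  show "AE \<omega> in coins. (\<lambda>k. score \<epsilon> u (play n SI SII x \<omega> k)) \<longlonglongrightarrow> payoff n \<epsilon> F SI SII x \<omega>"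
    by (rule score_tendsto_payoff [OF strategies boundary ends])
  show "\<bar>score \<epsilon> u (play n SI SII x \<omega> k)\<bar> \<le> \<bar>Max (u ` {..n + 1})\<bar> + \<bar>Min (u ` {..n + 1})\<bar>" for \<omega> k
  proof -
    have "Min (u ` {..n + 1}) \<le> u (current (play n SI SII x \<omega> k))"
      using current_play_le [OF strategies] by (intro Min_le) auto
    then have "Min (u ` {..n + 1}) \<le> score \<epsilon> u (play n SI SII x \<omega> k)"
      using \<open>\<epsilon> \<ge> 0\<close> by (simp add: score_def add_increasing2)
    with bound [of \<omega> k] show ?thesis
      by linarith
  qed
  show "(\<integral>\<omega>. score \<epsilon> u (play n SI SII x \<omega> k) \<partial>coins) \<ge> u x" for k
    using submartingale_play [where g = "score \<epsilon> u", OF step] by simp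
qed simp_all

section \<open>Values from guarantees, and the guarantee of Player II\<close>

text \<open>One strategy per player that secures \<open>v\<close> against every opponent. The two
  payoffs differ only on games that may not end, and \<open>V_I\<close> is at most
  \<open>V_II\<close>, so each guarantee carries over to the other payoff.\<close>

lemma has_valueI:
  assumes SI: "SI \<in> strategiesI n" and SII: "SII \<in> strategiesII n"
    and ge: "\<And>SII. SII \<in> strategiesII n \<Longrightarrow> v \<le> V_I n \<epsilon> F SI SII x"
    and le: "\<And>SI. SI \<in> strategiesI n \<Longrightarrow> V_II n \<epsilon> F SI SII x \<le> v"
  shows "has_value n \<epsilon> F x v"
proof -
  have V_le: "V_I n \<epsilon> F S T x \<le> V_II n \<epsilon> F S T x" for S T
    by (simp add: V_I_def V_II_def)
  have "(SUP SI\<in>strategiesI n. INF SII\<in>strategiesII n. V_I n \<epsilon> F SI SII x) = v"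
  proof (rule antisym)
    show "(SUP SI\<in>strategiesI n. INF SII\<in>strategiesII n. V_I n \<epsilon> F SI SII x) \<le> v"
      by (intro SUP_least INF_lower2 [OF SII] order_trans [OF V_le le])
    show "v \<le> (SUP SI\<in>strategiesI n. INF SII\<in>strategiesII n. V_I n \<epsilon> F SI SII x)"
      by (intro SUP_upper2 [OF SI] INF_greatest ge)
  qed
  moreover have "(INF SII\<in>strategiesII n. SUP SI\<in>strategiesI n. V_II n \<epsilon> F SI SII x) = v"
  proof (rule antisym)
    show "(INF SII\<in>strategiesII n. SUP SI\<in>strategiesI n. V_II n \<epsilon> F SI SII x) \<le> v"
      by (intro INF_lower2 [OF SII] SUP_least le)
    show "v \<le> (INF SII\<in>strategiesII n. SUP SI\<in>strategiesI n. V_II n \<epsilon> F SI SII x)"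
      by (intro INF_greatest SUP_upper2 [OF SI] order_trans [OF ge V_le])
  qed
  ultimately show ?thesis
    by (simp add: has_value_def)
qed

lemma toss_right_on_strategy: "toss_right_on n A \<in> strategiesI n"
  by (auto simp: toss_right_on_def positional_def strategiesI_def running_histories_def
      running_def neighbors_def)

lemma move_left_on_strategy: "move_left_on n A \<in> strategiesII n"
  by (auto simp: move_left_on_def positional_def strategiesII_def running_histories_def
      running_def neighbors_def)

lemma toss_right_on_eq:
  "current h \<in> running n \<Longrightarrow>
    toss_right_on n A h = (if current h \<in> A then Toss (current h + 1) else Force)"
  by (simp add: toss_right_on_def positional_def running_histories_def)

lemma move_left_on_eq:
  "current h \<in> running n \<Longrightarrow>
    move_left_on n A h = (if current h \<in> A then current h - 1 else current h + 1)"
  by (simp add: move_left_on_def positional_def running_histories_def)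

text \<open>Here \<open>d\<close> is the number of steps to the end that Player II is heading for.
  With \<open>q = (1/3) ^ d\<close>, a move of Player II lowers the potential \<open>1 - q\<close>
  by \<open>2 * q\<close>, while a toss won by Player I raises it by at most \<open>q\<close>, since
  it never exceeds 1. So a toss loses at least \<open>q / 2\<close> on average, and a forced turn
  loses more.\<close>

lemma ends_almost_surely_move_left_on:
  assumes "k \<le> n"
  shows "ends_almost_surely n SI (move_left_on n {1..k}) x"
proof -
  define d where "d i = (if i \<le> k then i else n + 1 - i)" for i :: nat
  define \<phi> :: "history \<Rightarrow> real" where "\<phi> h = 1 - (1/3) ^ d (current h)" for h
  \<comment> \<open>A lower bound for \<open>q\<close> at all running nodes, where \<open>d\<close>
    is at most \<open>n\<close>; this makes the drift uniform.\<close>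
  define p :: real where "p = (1/3) ^ n"
  show ?thesis
  proof (rule ends_almost_surely_drift)
    show "p / 2 > 0"
      by (simp add: p_def)
    show "\<phi> h \<ge> 0" for h
      by (simp add: \<phi>_def power_le_one)
  next
    fix h
    assume h: "current h \<in> running n"
    let ?s = "move_left_on n {1..k} h"
    define q :: real where "q = (1/3) ^ d (current h)"
    have s: "d (current h) = Suc (d ?s)" "d (current h) \<le> n"
      using h assms by (auto simp: move_left_on_eq d_def running_def)
    have s': "\<phi> (Move h a ?s) = 1 - 3 * q" for a
      unfolding q_def s(1) by (simp add: \<phi>_def)
    have le_1: "\<phi> h' \<le> 1" for h'
      by (simp add: \<phi>_def)
    have q: "\<phi> h = 1 - q" "p \<le> q" "0 \<le> q"
      using s(2) unfolding \<phi>_def p_def q_def by (simp_all add: power_decreasing)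
    show "\<phi> (next_history n SI (move_left_on n {1..k}) True h) +
        \<phi> (next_history n SI (move_left_on n {1..k}) False h) \<le> 2 * (\<phi> h - p / 2)"
    proof (cases "SI h")
      case (Toss y)
      then have "next_history n SI (move_left_on n {1..k}) True h = Move h I_Won y"
        "next_history n SI (move_left_on n {1..k}) False h = Move h II_Won ?s"
        using h by (simp_all add: next_history_def)
      then show ?thesis
        using q le_1 [of "Move h I_Won y"] s'[of II_Won] by (simp add: algebra_simps)
    next
      case Force
      then have "next_history n SI (move_left_on n {1..k}) c h = Move h II_Forced ?s" for c
        using h by (simp add: next_history_def)
      then show ?thesis
        using q s'[of II_Forced] by (simp add: algebra_simps)
    qed
  qed
qed

text \<open>In \<open>left\<close> and \<open>right\<close>, the first inequality handles a forced
  turn and the second a toss in which the players pull in opposite directions.\<close>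

lemma V_II_move_left_on_le:
  assumes "\<epsilon> \<ge> 0" and "k \<le> n" and SI: "SI \<in> strategiesI n" and "x \<le> n + 1"
    and boundary: "u 0 = F 0" "u (n + 1) = F (n + 1)"
    and left: "\<And>i. i \<in> {1..k} \<Longrightarrow> u (i - 1) + \<epsilon> \<le> u i \<and> u (i - 1) + u (i + 1) \<le> 2 * u i"
    and right: "\<And>i. i \<in> {k + 1..n} \<Longrightarrow> u (i + 1) + \<epsilon> \<le> u i \<and> u (i - 1) + u (i + 1) \<le> 2 * u i"
  shows "V_II n \<epsilon> F SI (move_left_on n {1..k}) x \<le> ereal (u x)"
proof -
  let ?SII = "move_left_on n {1..k}"
  have ends: "ends_almost_surely n SI ?SII x"
    using \<open>k \<le> n\<close> by (rule ends_almost_surely_move_left_on)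
  have "expected_payoff n \<epsilon> F SI ?SII x \<le> ereal (u x)"
  proof (rule expected_payoff_le [OF \<open>\<epsilon> \<ge> 0\<close> SI move_left_on_strategy \<open>x \<le> n + 1\<close> boundary ends])
    fix h
    assume h: "current h \<in> running n"
    let ?i = "current h"
    have i: "?i \<in> {1..k} \<or> ?i \<in> {k + 1..n}"
      using h by (auto simp: running_def)
    have forced: "u (?SII h) + \<epsilon> \<le> u ?i"
      using i left right h by (auto simp: move_left_on_eq)
    \<comment> \<open>If Player I would move to the same neighbour as Player II, the inequality for
      forced turns suffices, because \<open>\<epsilon>\<close> is nonnegative.\<close>
    have toss: "u (?SII h) + u y \<le> 2 * u ?i" if "y \<in> neighbors n ?i" for y
    proof -
      have y: "y = ?i - 1 \<or> y = ?i + 1"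
        using that by (auto simp: neighbors_def)
      show "u (?SII h) + u y \<le> 2 * u ?i"
        using i
      proof
        assume "?i \<in> {1..k}"
        then show ?thesis
          using left [of ?i] y h \<open>\<epsilon> \<ge> 0\<close> by (auto simp: move_left_on_eq)
      next
        assume "?i \<in> {k + 1..n}"
        then show ?thesis
          using right [of ?i] y h \<open>\<epsilon> \<ge> 0\<close> by (auto simp: move_left_on_eq)
      qed
    qed
    have "SI h \<in> insert Force (Toss ` neighbors n ?i)"
      using PiE_mem [OF SI [unfolded strategiesI_def]] h by (simp add: running_histories_def)
    then show "score \<epsilon> u (next_history n SI ?SII True h) + score \<epsilon> u (next_history n SI ?SII False h)
        \<le> 2 * score \<epsilon> u h"
    proof
      assume "SI h = Force"
      then show ?thesis
        using h forced by (simp add: next_history_def score_def algebra_simps)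
    next
      assume "SI h \<in> Toss ` neighbors n ?i"
      then obtain y where "SI h = Toss y" "y \<in> neighbors n ?i"
        by blast
      then show ?thesis
        using h toss [of y] by (simp add: next_history_def score_def algebra_simps)
    qed
  qed
  with ends show ?thesis
    by (simp add: V_II_def)
qed

section \<open>Forcing a bounded number of times, then tossing\<close>

text \<open>Player I's guarantee in cases (b) and (c). Unlike the strategies in the theorem it is
  not positional: it reads the number of payments off the history.\<close>

definition force_then_toss :: "nat \<Rightarrow> nat \<Rightarrow> history \<Rightarrow> choiceI" where
  "force_then_toss n N =
     (\<lambda>h\<in>running_histories n. if num_forced h < N then Force else Toss (current h + 1))"

lemma force_then_toss_strategy: "force_then_toss n N \<in> strategiesI n"
  by (auto simp: force_then_toss_def strategiesI_def running_histories_def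
      running_def neighbors_def)

lemma force_then_toss_eq:
  "current h \<in> running n \<Longrightarrow>
    force_then_toss n N h = (if num_forced h < N then Force else Toss (current h + 1))"
  by (simp add: force_then_toss_def running_histories_def)

lemma force_then_toss_0: "force_then_toss n 0 = toss_right_on n {1..n}"
  by (auto simp: force_then_toss_def toss_right_on_def positional_def running_histories_def
      running_def fun_eq_iff restrict_def)

text \<open>The potential adds the remaining budget of forced turns, a truncated difference that is
  0 once the budget is spent, to the potential for reaching the right end. A forced turn uses up 1
  of the budget and raises the rest by at most \<open>q\<close>. The case \<open>N = 0\<close> is
  tossing everywhere.\<close>

lemma ends_almost_surely_force_then_toss:
  "ends_almost_surely n (force_then_toss n N) SII x"
proof -
  let ?SI = "force_then_toss n N"
  define d where "d i = n + 1 - i" for i :: nat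
  define \<phi> :: "history \<Rightarrow> real"
    where "\<phi> h = real (N - num_forced h) + 1 - (1/3) ^ d (current h)" for h
  define p :: real where "p = (1/3) ^ n"
  show ?thesis
  proof (rule ends_almost_surely_drift)
    show "p / 2 > 0"
      by (simp add: p_def)
    show "\<phi> h \<ge> 0" for h
    proof -
      have "(1/3 :: real) ^ d (current h) \<le> 1"
        by (simp add: power_le_one)
      then show ?thesis
        by (simp add: \<phi>_def)
    qed
  next
    fix h
    assume h: "current h \<in> running n"
    define q :: real where "q = (1/3) ^ d (current h)"
    have d: "d (current h) = Suc (d (current h + 1))" "d (current h) \<le> n"
      using h by (auto simp: d_def running_def)
    have q: "p \<le> q" "q = (1/3) ^ d (current h + 1) / 3"
      using d(2) unfolding p_def q_def by (intro power_decreasing) (auto simp: d(1))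
    \<comment> \<open>A running node is at least one step from the right end. So a forced turn
      lowers the potential by at least \<open>1 - q\<close>, which exceeds
      \<open>p / 2\<close>.\<close>
    have q_le: "q \<le> 1 / 3"
      unfolding q(2) by (simp add: power_le_one)
    show "\<phi> (next_history n ?SI SII True h) + \<phi> (next_history n ?SI SII False h)
        \<le> 2 * (\<phi> h - p / 2)"
    proof (cases "num_forced h < N")
      case True
      then have "next_history n ?SI SII c h = Move h II_Forced (SII h)" for c
        using h by (simp add: next_history_def force_then_toss_eq)
      moreover have "real (N - num_forced h) = real (N - Suc (num_forced h)) + 1"
        using True by simp
      then have "\<phi> h = real (N - Suc (num_forced h)) + 2 - q"
        by (simp add: \<phi>_def q_def)
      moreover have "\<phi> (Move h II_Forced (SII h)) \<le> real (N - Suc (num_forced h)) + 1"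
        by (simp add: \<phi>_def)
      ultimately show ?thesis
        using q(1) q_le by (simp add: algebra_simps)
    next
      case False
      then have "next_history n ?SI SII True h = Move h I_Won (current h + 1)"
        "next_history n ?SI SII False h = Move h II_Won (SII h)"
        using h by (simp_all add: next_history_def force_then_toss_eq)
      moreover have "\<phi> h = 1 - q" "\<phi> (Move h I_Won (current h + 1)) = 1 - 3 * q"
        "\<phi> (Move h II_Won (SII h)) \<le> 1"
        using False q(2) by (simp_all add: \<phi>_def q_def)
      ultimately show ?thesis
        using q(1) by (simp add: algebra_simps)
    qed
  qed
qed

text \<open>
  Forcing for ever would let Player II prolong the game indefinitely, at the cost \<open>-\<infinity>\<close> for
  Player I. After \<open>N\<close> forced turns, however, what has been collected already outweighs the value.
\<close>

lemma V_I_force_then_toss_ge: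
  assumes "\<epsilon> \<ge> 0" and SII: "SII \<in> strategiesII n" and "x \<le> n + 1"
    and boundary: "u 0 = F 0" "u (n + 1) = F (n + 1)"
    and forced: "\<And>i j. i \<in> running n \<Longrightarrow> j \<in> neighbors n i \<Longrightarrow> u i \<le> u j + \<epsilon>"
    and N: "u x \<le> F 0 + real N * \<epsilon>" "u x \<le> F (n + 1) + real N * \<epsilon>"
  shows "ereal (u x) \<le> V_I n \<epsilon> F (force_then_toss n N) SII x"
proof -
  let ?SI = "force_then_toss n N"
  \<comment> \<open>A pathwise invariant: as long as the budget lasts all turns were forced, and
    each of them pays \<open>\<epsilon>\<close> while \<open>u\<close> drops by at most
    \<open>\<epsilon>\<close>. At the end of the play either alternative bounds the payoff, the
    first one by the choice of \<open>N\<close>.\<close>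
  have inv: "N \<le> num_forced (play n ?SI SII x \<omega> k) \<or> u x \<le> score \<epsilon> u (play n ?SI SII x \<omega> k)" for \<omega> k
  proof (induction k)
    case (Suc k)
    define h where "h = play n ?SI SII x \<omega> k"
    show ?case
    proof (cases "current h \<in> running n")
      case True
      then have "SII h \<in> neighbors n (current h)"
        using PiE_mem [OF SII [unfolded strategiesII_def]] by (simp add: running_histories_def)
      from forced [OF True this] show ?thesis
        using Suc.IH True unfolding play.simps h_def [symmetric]
        by (auto simp: next_history_def force_then_toss_eq score_def algebra_simps)
    qed (use Suc in \<open>simp add: h_def\<close>)
  qed simp
  have "u x \<le> payoff n \<epsilon> F ?SI SII x \<omega>" if ends: "\<exists>k. current (play n ?SI SII x \<omega> k) \<notin> running n" for \<omega>
  proof -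
    obtain k where stopped: "current (play n ?SI SII x \<omega> k) \<notin> running n"
      and payoff: "payoff n \<epsilon> F ?SI SII x \<omega> =
        F (current (play n ?SI SII x \<omega> k)) + real (num_forced (play n ?SI SII x \<omega> k)) * \<epsilon>"
      using payoff_eventually [OF ends, of \<epsilon> F] by (auto simp: eventually_sequentially)
    have "current (play n ?SI SII x \<omega> k) = 0 \<or> current (play n ?SI SII x \<omega> k) = n + 1"
      using current_play_le [OF force_then_toss_strategy SII \<open>x \<le> n + 1\<close>] stopped
      by (rule stopped_at_terminal)
    moreover have "real N * \<epsilon> \<le> real (num_forced (play n ?SI SII x \<omega> k)) * \<epsilon>"
      if "N \<le> num_forced (play n ?SI SII x \<omega> k)"
      using that \<open>\<epsilon> \<ge> 0\<close> by (intro mult_right_mono) simp_all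
    ultimately show ?thesis
      using inv [of \<omega> k] N boundary unfolding payoff score_def by fastforce
  qed
  moreover have ends: "ends_almost_surely n ?SI SII x"
    by (rule ends_almost_surely_force_then_toss)
  ultimately have "ereal (u x) \<le> expected_payoff n \<epsilon> F ?SI SII x"
    unfolding expected_payoff_def ends_almost_surely_def
    by (intro coins.ext_expectation_ge_const) (auto elim!: eventually_mono)
  with ends show ?thesis
    by (simp add: V_I_def)
qed

section \<open>Bounded scores: tossing everywhere, and the pairs that realize the value\<close>

lemma score_bound_all_toss:
  assumes SII: "SII \<in> strategiesII n" and "x \<le> n + 1"
  shows "score \<epsilon> u (play n (toss_right_on n {1..n}) SII x \<omega> k) \<le> Max (u ` {..n + 1})"
proof -
  let ?h = "play n (toss_right_on n {1..n}) SII x \<omega> k"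
  have "num_forced ?h = 0"
    by (induction k) (auto simp: next_history_def toss_right_on_eq running_def)
  moreover have "u (current ?h) \<le> Max (u ` {..n + 1})"
    using current_play_le [OF toss_right_on_strategy assms] by (intro Max_ge) auto
  ultimately show ?thesis
    by (simp add: score_def)
qed

text \<open>Player II may answer in both directions: for the left neighbour \<open>toss\<close> is
  midpoint convexity of \<open>u\<close>, for the right one it is monotonicity. Without payments the
  score is a value of \<open>u\<close>, hence bounded.\<close>

lemma V_I_all_toss_ge:
  assumes "\<epsilon> \<ge> 0" and SII: "SII \<in> strategiesII n" and "x \<le> n + 1"
    and boundary: "u 0 = F 0" "u (n + 1) = F (n + 1)"
    and toss: "\<And>i j. i \<in> running n \<Longrightarrow> j \<in> neighbors n i \<Longrightarrow> 2 * u i \<le> u (i + 1) + u j"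
  shows "ereal (u x) \<le> V_I n \<epsilon> F (toss_right_on n {1..n}) SII x"
proof -
  let ?SI = "toss_right_on n {1..n}"
  have ends: "ends_almost_surely n ?SI SII x"
    using ends_almost_surely_force_then_toss [of n 0] by (simp add: force_then_toss_0)
  have "ereal (u x) \<le> expected_payoff n \<epsilon> F ?SI SII x"
  proof (rule expected_payoff_ge [OF \<open>\<epsilon> \<ge> 0\<close> toss_right_on_strategy SII \<open>x \<le> n + 1\<close> boundary ends])
    fix h
    assume h: "current h \<in> running n"
    then have "SII h \<in> neighbors n (current h)"
      using PiE_mem [OF SII [unfolded strategiesII_def]] by (simp add: running_histories_def)
    from toss [OF h this] h
    show "2 * score \<epsilon> u h
        \<le> score \<epsilon> u (next_history n ?SI SII True h) + score \<epsilon> u (next_history n ?SI SII False h)"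
      by (auto simp: next_history_def toss_right_on_eq score_def running_def)
  next
    show "score \<epsilon> u (play n ?SI SII x \<omega> k) \<le> Max (u ` {..n + 1})" for \<omega> k
      using SII \<open>x \<le> n + 1\<close> by (rule score_bound_all_toss)
  qed
  with ends show ?thesis
    by (simp add: V_I_def)
qed

text \<open>
  Against \<open>move_left_on n {1..k}\<close> the token cannot return to \<open>{j + 1..k}\<close> after a forced turn, and the
  score is constant from then on; hence it stays bounded although a turn may add \<open>\<epsilon>\<close>.
\<close>

lemma expected_payoff_toss_right_on_ge:
  assumes "\<epsilon> \<ge> 0" and "j \<le> k" and "k \<le> n" and "x \<le> n + 1"
    and boundary: "u 0 = F 0" "u (n + 1) = F (n + 1)"
    and forced_left: "\<And>i. i \<in> {1..j} \<Longrightarrow> u i = u (i - 1) + \<epsilon>"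
    and toss: "\<And>i. i \<in> {j + 1..k} \<Longrightarrow> 2 * u i = u (i - 1) + u (i + 1)"
    and forced_right: "\<And>i. i \<in> {k + 1..n} \<Longrightarrow> u i = u (i + 1) + \<epsilon>"
  shows "ereal (u x) \<le> expected_payoff n \<epsilon> F (toss_right_on n {j + 1..k}) (move_left_on n {1..k}) x"
proof -
  let ?SI = "toss_right_on n {j + 1..k}" and ?SII = "move_left_on n {1..k}"
  have next_toss: "next_history n ?SI ?SII c h =
      (if c then Move h I_Won (current h + 1) else Move h II_Won (current h - 1))"
    if "current h \<in> {j + 1..k}" for c h
    using that \<open>k \<le> n\<close> by (auto simp: next_history_def toss_right_on_eq move_left_on_eq running_def)
  have next_left: "next_history n ?SI ?SII c h = Move h II_Forced (current h - 1)"
    if "current h \<in> {1..j}" for c h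
    using that \<open>j \<le> k\<close> \<open>k \<le> n\<close>
    by (auto simp: next_history_def toss_right_on_eq move_left_on_eq running_def)
  have next_right: "next_history n ?SI ?SII c h = Move h II_Forced (current h + 1)"
    if "current h \<in> {k + 1..n}" for c h
    using that by (auto simp: next_history_def toss_right_on_eq move_left_on_eq running_def)
  have cases: "current h \<in> {1..j} \<or> current h \<in> {j + 1..k} \<or> current h \<in> {k + 1..n}"
    if "current h \<in> running n" for h
    using that by (auto simp: running_def)
  show ?thesis
  proof (rule expected_payoff_ge [OF \<open>\<epsilon> \<ge> 0\<close> toss_right_on_strategy move_left_on_strategy \<open>x \<le> n + 1\<close>
        boundary ends_almost_surely_move_left_on [OF \<open>k \<le> n\<close>]])
    fix h
    assume "current h \<in> running n"
    then consider "current h \<in> {1..j}" | "current h \<in> {j + 1..k}" | "current h \<in> {k + 1..n}"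
      using cases by blast
    then show "2 * score \<epsilon> u h
        \<le> score \<epsilon> u (next_history n ?SI ?SII True h) + score \<epsilon> u (next_history n ?SI ?SII False h)"
    proof cases
      case 1
      show ?thesis
        unfolding next_left [OF 1] using forced_left [OF 1] by (simp add: score_def algebra_simps)
    next
      case 2
      show ?thesis
        unfolding next_toss [OF 2] using toss [OF 2] by (simp add: score_def algebra_simps)
    next
      case 3
      show ?thesis
        unfolding next_right [OF 3] using forced_right [OF 3] by (simp add: score_def algebra_simps)
    qed
  next
    fix \<omega> k'
    let ?C = "Max (u ` {..n + 1})"
    have u_le: "u i \<le> ?C" if "i \<le> n + 1" for i
      using that by (intro Max_ge) auto
    \<comment> \<open>The second conjunct carries the induction: a toss may raise the score, but
      with no payment made so far the new score is a value of \<open>u\<close>.\<close>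
    have "score \<epsilon> u (play n ?SI ?SII x \<omega> k') \<le> ?C \<and>
        (current (play n ?SI ?SII x \<omega> k') \<in> {j + 1..k} \<longrightarrow> num_forced (play n ?SI ?SII x \<omega> k') = 0)"
    proof (induction k')
      case 0
      then show ?case
        using u_le [OF \<open>x \<le> n + 1\<close>] by simp
    next
      case (Suc k')
      define h where "h = play n ?SI ?SII x \<omega> k'"
      note IH = Suc.IH [folded h_def]
      consider "current h \<notin> running n" | "current h \<in> {1..j}" | "current h \<in> {j + 1..k}"
        | "current h \<in> {k + 1..n}"
        using cases by blast
      then show ?case
      proof cases
        case 1
        then show ?thesis
          unfolding play.simps h_def [symmetric] using IH by simp
      next
        case 2
        then show ?thesis
          unfolding play.simps h_def [symmetric] next_left [OF 2]
          using IH forced_left [OF 2] by (auto simp: score_def algebra_simps)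
      next
        case 3
        then have "current h + 1 \<le> n + 1" "current h - 1 \<le> n + 1"
          using \<open>k \<le> n\<close> by auto
        from this [THEN u_le] show ?thesis
          unfolding play.simps h_def [symmetric] next_toss [OF 3] using IH 3
          by (simp add: score_def)
      next
        case 4
        then show ?thesis
          unfolding play.simps h_def [symmetric] next_right [OF 4]
          using IH forced_right [OF 4] by (auto simp: score_def algebra_simps)
      qed
    qed
    then show "score \<epsilon> u (play n ?SI ?SII x \<omega> k') \<le> ?C"
      by simp
  qed
qed

text \<open>Player II's guarantee, applied to this one opponent, is the upper bound; the bounded
  martingale is the lower one. Taking \<open>j = 0\<close> and \<open>k = n\<close> gives tossing
  everywhere, \<open>j = k\<close> forcing everywhere.\<close>

lemma realizes_value_toss_right_on:
  assumes "\<epsilon> \<ge> 0" and "j \<le> k" and "k \<le> n"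
    and boundary: "u 0 = F 0" "u (n + 1) = F (n + 1)"
    and le: "\<And>SI x. SI \<in> strategiesI n \<Longrightarrow> x \<le> n + 1 \<Longrightarrow>
      V_II n \<epsilon> F SI (move_left_on n {1..k}) x \<le> ereal (u x)"
    and val: "\<And>x. x \<le> n + 1 \<Longrightarrow> has_value n \<epsilon> F x (ereal (u x))"
    and forced_left: "\<And>i. i \<in> {1..j} \<Longrightarrow> u i = u (i - 1) + \<epsilon>"
    and toss: "\<And>i. i \<in> {j + 1..k} \<Longrightarrow> 2 * u i = u (i - 1) + u (i + 1)"
    and forced_right: "\<And>i. i \<in> {k + 1..n} \<Longrightarrow> u i = u (i + 1) + \<epsilon>"
  shows "realizes_value n \<epsilon> F (toss_right_on n {j + 1..k}) (move_left_on n {1..k})"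
  unfolding realizes_value_def
proof (intro conjI ballI toss_right_on_strategy move_left_on_strategy)
  fix x
  assume "x \<in> running n"
  then have x: "x \<le> n + 1"
    by (simp add: running_def)
  show ends: "ends_almost_surely n (toss_right_on n {j + 1..k}) (move_left_on n {1..k}) x"
    using \<open>k \<le> n\<close> by (rule ends_almost_surely_move_left_on)
  have "expected_payoff n \<epsilon> F (toss_right_on n {j + 1..k}) (move_left_on n {1..k}) x \<le> ereal (u x)"
    using le [OF toss_right_on_strategy [of n "{j + 1..k}"] x] ends by (simp add: V_II_def)
  moreover have "ereal (u x) \<le>
      expected_payoff n \<epsilon> F (toss_right_on n {j + 1..k}) (move_left_on n {1..k}) x"
    by (rule expected_payoff_toss_right_on_ge) (fact assms x)+
  ultimately have "expected_payoff n \<epsilon> F (toss_right_on n {j + 1..k}) (move_left_on n {1..k}) x = ereal (u x)"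
    by (rule antisym)
  then show "has_value n \<epsilon> F x
      (expected_payoff n \<epsilon> F (toss_right_on n {j + 1..k}) (move_left_on n {1..k}) x)"
    using val [OF x] by simp
qed

section \<open>The linear value and the forced value\<close>

text \<open>A linear \<open>u\<close> is preserved on average by tosses in opposite directions. That
  \<open>\<epsilon>\<close> is at most the slope \<open>s\<close> means that the payment for a
  forced turn does not make up for the step to the left.\<close>

lemma linear_value:
  fixes s :: real and F :: "nat \<Rightarrow> real"
  defines "u \<equiv> \<lambda>i. F 0 + real i * s"
  assumes "\<epsilon> \<ge> 0" and "\<epsilon> \<le> s" and boundary: "F (n + 1) = u (n + 1)"
  shows "x \<le> n + 1 \<Longrightarrow> has_value n \<epsilon> F x (ereal (u x))"
    and "realizes_value n \<epsilon> F (toss_right_on n {1..n}) (move_left_on n {1..n})"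
proof -
  have bd: "u 0 = F 0" "u (n + 1) = F (n + 1)"
    using boundary by (simp_all add: u_def)
  have pred: "u (i - 1) = u i - s" if "i \<ge> 1" for i
    using that by (simp add: u_def of_nat_diff algebra_simps)
  have succ: "u (i + 1) = u i + s" for i
    by (simp add: u_def algebra_simps)
  have le: "V_II n \<epsilon> F SI (move_left_on n {1..n}) x \<le> ereal (u x)"
    if SI: "SI \<in> strategiesI n" and x: "x \<le> n + 1" for SI x
  proof (rule V_II_move_left_on_le [OF \<open>\<epsilon> \<ge> 0\<close> order_refl SI x bd])
    show "u (i - 1) + \<epsilon> \<le> u i \<and> u (i - 1) + u (i + 1) \<le> 2 * u i" if "i \<in> {1..n}" for i
      using that pred [of i] succ [of i] \<open>\<epsilon> \<le> s\<close> by auto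
  qed auto
  have ge: "ereal (u x) \<le> V_I n \<epsilon> F (toss_right_on n {1..n}) SII x"
    if SII: "SII \<in> strategiesII n" and x: "x \<le> n + 1" for SII x
  proof (rule V_I_all_toss_ge [OF \<open>\<epsilon> \<ge> 0\<close> SII x bd])
    show "2 * u i \<le> u (i + 1) + u j" if "i \<in> running n" "j \<in> neighbors n i" for i j
    proof -
      have "j = i + 1 \<or> j = i - 1"
        using that by (auto simp: neighbors_def)
      then show ?thesis
        using that(1) pred [of i] succ [of i] \<open>\<epsilon> \<ge> 0\<close> \<open>\<epsilon> \<le> s\<close> by (auto simp: running_def)
    qed
  qed
  show val: "has_value n \<epsilon> F x (ereal (u x))" if "x \<le> n + 1" for x
    by (rule has_valueI [OF toss_right_on_strategy move_left_on_strategy ge le])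
      (use that in simp_all)
  have "realizes_value n \<epsilon> F (toss_right_on n {0 + 1..n}) (move_left_on n {1..n})"
  proof (rule realizes_value_toss_right_on [OF \<open>\<epsilon> \<ge> 0\<close> le0 order_refl bd le val])
    show "2 * u i = u (i - 1) + u (i + 1)" if "i \<in> {0 + 1..n}" for i
      using that pred [of i] succ [of i] by simp
  qed auto
  then show "realizes_value n \<epsilon> F (toss_right_on n {1..n}) (move_left_on n {1..n})"
    by simp
qed

text \<open>Player II pays \<open>\<epsilon>\<close> per step and leaves by one of the two ends;
  under the bounds on \<open>k\<close> in the next lemma this is the minimum of the two costs. For
  \<open>k = n\<close> the second branch only serves \<open>i = n + 1\<close>, where it is
  \<open>F (n + 1)\<close>, and case (b) results.\<close>

definition forced_value :: "nat \<Rightarrow> real \<Rightarrow> (nat \<Rightarrow> real) \<Rightarrow> nat \<Rightarrow> nat \<Rightarrow> real" where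
  "forced_value n \<epsilon> F k i =
     (if i \<le> k then F 0 + real i * \<epsilon> else F (n + 1) + (real n + 1 - real i) * \<epsilon>)"

text \<open>\<open>u\<close> has slope \<open>\<epsilon>\<close> up to \<open>k\<close> and
  \<open>-\<epsilon>\<close> from \<open>k + 1\<close> on, and \<open>lower\<close> and
  \<open>upper\<close> bound the jump in between by \<open>\<epsilon>\<close>. So \<open>u\<close>
  changes by at most \<open>\<epsilon>\<close> per step, as Player I's guarantee requires; with the
  exact slope on the side to which Player II moves, this gives the midpoint inequality too.\<close>

lemma forced_value:
  fixes n k :: nat and \<epsilon> :: real and F :: "nat \<Rightarrow> real"
  defines "u \<equiv> forced_value n \<epsilon> F k"
  assumes "\<epsilon> > 0" and "k \<le> n"
    and lower: "(2 * real k - real n - 1) * \<epsilon> \<le> F (n + 1) - F 0"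
    and upper: "F (n + 1) - F 0 \<le> (2 * real k - real n + 1) * \<epsilon>"
  shows "x \<le> n + 1 \<Longrightarrow> has_value n \<epsilon> F x (ereal (u x))"
    and "realizes_value n \<epsilon> F (toss_right_on n {}) (move_left_on n {1..k})"
    and "F (n + 1) - F 0 = (2 * real k - real n + 1) * \<epsilon> \<Longrightarrow> j \<le> k \<Longrightarrow>
      realizes_value n \<epsilon> F (toss_right_on n {j + 1..k}) (move_left_on n {1..k})"
proof -
  have bd: "u 0 = F 0" "u (n + 1) = F (n + 1)"
    using \<open>k \<le> n\<close> by (simp_all add: u_def forced_value_def)
  have left: "u i = u (i - 1) + \<epsilon>" if "i \<in> {1..k}" for i
    using that by (cases i) (auto simp: u_def forced_value_def algebra_simps)
  have right: "u i = u (i + 1) + \<epsilon>" if "i \<in> {k + 1..n}" for i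
    using that by (simp add: u_def forced_value_def algebra_simps)
  have peak: "u k \<le> u (k + 1) + \<epsilon>" "u (k + 1) \<le> u k + \<epsilon>"
    using lower upper by (simp_all add: u_def forced_value_def algebra_simps)
  have lipschitz: "u i \<le> u (i + 1) + \<epsilon> \<and> u (i + 1) \<le> u i + \<epsilon>" if "i \<le> n" for i
  proof -
    consider "i < k" | "i = k" | "k < i"
      by linarith
    then show ?thesis
    proof cases
      case 1
      then show ?thesis
        using left [of "i + 1"] \<open>\<epsilon> > 0\<close> by simp
    next
      case 2
      then show ?thesis
        using peak by simp
    next
      case 3
      then show ?thesis
        using right [of i] that \<open>\<epsilon> > 0\<close> by simp
    qed
  qed
  have lipschitz': "u i \<le> u (i - 1) + \<epsilon> \<and> u (i - 1) \<le> u i + \<epsilon>" if "1 \<le> i" "i \<le> n" for i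
    using lipschitz [of "i - 1"] that by simp
  have le: "V_II n \<epsilon> F SI (move_left_on n {1..k}) x \<le> ereal (u x)"
    if SI: "SI \<in> strategiesI n" and x: "x \<le> n + 1" for SI x
  proof (rule V_II_move_left_on_le [OF less_imp_le [OF \<open>\<epsilon> > 0\<close>] \<open>k \<le> n\<close> SI x bd])
    show "u (i - 1) + \<epsilon> \<le> u i \<and> u (i - 1) + u (i + 1) \<le> 2 * u i" if "i \<in> {1..k}" for i
      using left [OF that] lipschitz [of i] that \<open>k \<le> n\<close> by auto
    show "u (i + 1) + \<epsilon> \<le> u i \<and> u (i - 1) + u (i + 1) \<le> 2 * u i" if "i \<in> {k + 1..n}" for i
      using right [OF that] lipschitz' [of i] that by auto
  qed
  show val: "has_value n \<epsilon> F x (ereal (u x))" if x: "x \<le> n + 1" for x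
  proof -
    \<comment> \<open>Enough payments to lift the smaller of the two terminal payoffs above
      \<open>u x\<close>.\<close>
    obtain N where "u x - min (F 0) (F (n + 1)) < real N * \<epsilon>"
      using reals_Archimedean3 [OF \<open>\<epsilon> > 0\<close>] by blast
    then have N: "u x \<le> F 0 + real N * \<epsilon>" "u x \<le> F (n + 1) + real N * \<epsilon>"
      by linarith+
    show ?thesis
    proof (rule has_valueI [OF force_then_toss_strategy move_left_on_strategy])
      show "ereal (u x) \<le> V_I n \<epsilon> F (force_then_toss n N) SII x" if SII: "SII \<in> strategiesII n" for SII
      proof (rule V_I_force_then_toss_ge [OF less_imp_le [OF \<open>\<epsilon> > 0\<close>] SII x bd _ N])
        show "u i \<le> u j + \<epsilon>" if "i \<in> running n" "j \<in> neighbors n i" for i j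
        proof -
          have "j = i + 1 \<or> j = i - 1"
            using that by (auto simp: neighbors_def)
          then show ?thesis
            using that(1) lipschitz [of i] lipschitz' [of i] by (auto simp: running_def)
        qed
      qed
      show "V_II n \<epsilon> F SI (move_left_on n {1..k}) x \<le> ereal (u x)" if "SI \<in> strategiesI n" for SI
        using that x by (rule le)
    qed
  qed
  note realizes = realizes_value_toss_right_on [OF less_imp_le [OF \<open>\<epsilon> > 0\<close>] _ \<open>k \<le> n\<close> bd le val]
  \<comment> \<open>The member \<open>j = k\<close> of the family: its tossing zone is
    empty.\<close>
  have "realizes_value n \<epsilon> F (toss_right_on n {k + 1..k}) (move_left_on n {1..k})"
    by (rule realizes) (auto simp: left right)
  then show "realizes_value n \<epsilon> F (toss_right_on n {}) (move_left_on n {1..k})"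
    by simp
  show "realizes_value n \<epsilon> F (toss_right_on n {j + 1..k}) (move_left_on n {1..k})"
    if eq: "F (n + 1) - F 0 = (2 * real k - real n + 1) * \<epsilon>" and "j \<le> k"
  proof (rule realizes)
    show "2 * u i = u (i - 1) + u (i + 1)" if "i \<in> {j + 1..k}" for i
    proof -
      \<comment> \<open>Equality in \<open>upper\<close> extends the slope \<open>\<epsilon>\<close>
        across the step from \<open>k\<close> to \<open>k + 1\<close>, so tossing is fair for
        \<open>u\<close> at \<open>k\<close> as well.\<close>
      have "u (i + 1) = u i + \<epsilon>"
      proof (cases "i = k")
        case True
        then show ?thesis
          using eq by (simp add: u_def forced_value_def algebra_simps)
      next
        case False
        then show ?thesis
          using left [of "i + 1"] that by simp
      qed
      then show ?thesis
        using left [of i] that by simp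
    qed
  qed (use \<open>j \<le> k\<close> left right in auto)
qed

section \<open>The cases in terms of \<open>Q\<close>\<close>

theorem theorem3p1:
  fixes n :: nat and \<epsilon> Q :: real and F :: "nat \<Rightarrow> real"
  assumes "n \<ge> 2" and "\<epsilon> > 0" and "F 0 \<le> F (n + 1)"
    and "Q = (F (n + 1) - F 0) / \<epsilon>"
  shows
    "(Q > real n + 1 \<or> (real n - 1 < Q \<and> Q \<le> real n + 1) \<or>
      (\<exists>k\<in>{1..n - 1}. 2 * real k - real n - 1 < Q \<and> Q \<le> 2 * real k - real n + 1)) \<and>
     (Q > real n + 1 \<longrightarrow>
        (\<forall>i\<in>{1..n}. has_value n \<epsilon> F i
           (ereal ((real n + 1 - real i) / (real n + 1) * F 0
                   + real i / (real n + 1) * F (n + 1)))) \<and>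
        realizes_value n \<epsilon> F (toss_right_on n {1..n}) (move_left_on n {1..n})) \<and>
     (real n - 1 < Q \<and> Q \<le> real n + 1 \<longrightarrow>
        (\<forall>i\<in>{1..n}. has_value n \<epsilon> F i (ereal (F 0 + real i * \<epsilon>))) \<and>
        realizes_value n \<epsilon> F (toss_right_on n {}) (move_left_on n {1..n}) \<and>
        (Q = real n + 1 \<longrightarrow>
           (\<forall>j\<in>{0..n}.
              realizes_value n \<epsilon> F (toss_right_on n {j + 1..n}) (move_left_on n {1..n})) \<and>
           (\<exists>j\<in>{0..n}. toss_right_on n {j + 1..n} = toss_right_on n {}))) \<and>
     (\<forall>k\<in>{1..n - 1}. 2 * real k - real n - 1 < Q \<and> Q \<le> 2 * real k - real n + 1 \<longrightarrow>
        (\<forall>i\<in>{1..n}. has_value n \<epsilon> F i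
           (ereal (if i \<le> k then F 0 + real i * \<epsilon>
                   else F (n + 1) + (real n + 1 - real i) * \<epsilon>))) \<and>
        realizes_value n \<epsilon> F (toss_right_on n {}) (move_left_on n {1..k}) \<and>
        (Q = 2 * real k - real n + 1 \<longrightarrow>
           (\<forall>j\<in>{0..k}.
              realizes_value n \<epsilon> F (toss_right_on n {j + 1..k}) (move_left_on n {1..k})) \<and>
           (\<exists>j\<in>{0..k}. toss_right_on n {j + 1..k} = toss_right_on n {})))"
    (is "?exhaustive \<and> ?a \<and> ?b \<and> ?c")
proof -
  have diff: "F (n + 1) - F 0 = Q * \<epsilon>"
    using assms by simp
  have "Q \<ge> 0"
    using assms by simp
  have exhaustive: ?exhaustive
  proof (cases "real n - 1 < Q")
    case False
    \<comment> \<open>The intervals of case (c) have length 2 and tile the line; this is the least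
      integer whose right endpoint \<open>2 * k - n + 1\<close> reaches \<open>Q\<close>.\<close>
    define k where "k = nat \<lceil>(Q + real n - 1) / 2\<rceil>"
    have "real k = of_int \<lceil>(Q + real n - 1) / 2\<rceil>"
      using \<open>Q \<ge> 0\<close> \<open>n \<ge> 2\<close> unfolding k_def by (intro of_nat_nat) simp
    then have "real k < (Q + real n - 1) / 2 + 1" "(Q + real n - 1) / 2 \<le> real k"
      by linarith+
    then have k: "2 * real k - real n - 1 < Q" "Q \<le> 2 * real k - real n + 1"
      by (simp_all add: field_simps)
    \<comment> \<open>The lower bound comes from \<open>Q \<ge> 0\<close> and
      \<open>n \<ge> 2\<close>, the upper one from \<open>Q \<le> n - 1\<close>.\<close>
    have "real k > 0" "real k < real n"
      using k False \<open>Q \<ge> 0\<close> of_nat_mono [OF \<open>n \<ge> 2\<close>, where ?'a = real]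
      by linarith+
    then have "k \<in> {1..n - 1}"
      by simp
    with k show ?thesis
      by blast
  next
    case True
    then show ?thesis
      by (cases "Q \<le> real n + 1") simp_all
  qed
  have a: ?a
  proof
    assume Q: "Q > real n + 1"
    \<comment> \<open>The slope of the interpolation; \<open>Q > n + 1\<close> says that it exceeds
      \<open>\<epsilon>\<close>.\<close>
    define s where "s = (F (n + 1) - F 0) / (real n + 1)"
    have s: "F (n + 1) = F 0 + real (n + 1) * s"
    proof -
      have "real (n + 1) = real n + 1" "real n + 1 \<noteq> 0"
        by simp_all
      then show ?thesis
        unfolding s_def by (simp only: nonzero_mult_div_cancel_left times_divide_eq_right) simp
    qed
    have "\<epsilon> \<le> s"
      using Q \<open>\<epsilon> > 0\<close> unfolding s_def diff by (simp add: le_divide_eq mult.commute)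
    note lin = linear_value [where F = F, OF less_imp_le [OF \<open>\<epsilon> > 0\<close>] this s]
    have "(real n + 1 - real i) / (real n + 1) * F 0 + real i / (real n + 1) * F (n + 1) =
        F 0 + real i * s" for i
    proof -
      have "(N - r) / N * a + r / N * b = a + r * ((b - a) / N)" if "N \<noteq> 0" for N r a b :: real
        using that by (simp add: field_simps)
      then show ?thesis
        unfolding s_def by simp
    qed
    with lin show "(\<forall>i\<in>{1..n}. has_value n \<epsilon> F i
           (ereal ((real n + 1 - real i) / (real n + 1) * F 0
                   + real i / (real n + 1) * F (n + 1)))) \<and>
        realizes_value n \<epsilon> F (toss_right_on n {1..n}) (move_left_on n {1..n})"
      by simp
  qed
  \<comment> \<open>Cases (b) and (c) at once: for \<open>k = n\<close> the interval for
    \<open>Q\<close> is that of (b), and all running nodes fall in the first branch.\<close>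
  have forced: "(\<forall>i\<in>{1..n}. has_value n \<epsilon> F i
           (ereal (if i \<le> k then F 0 + real i * \<epsilon>
                   else F (n + 1) + (real n + 1 - real i) * \<epsilon>))) \<and>
        realizes_value n \<epsilon> F (toss_right_on n {}) (move_left_on n {1..k}) \<and>
        (Q = 2 * real k - real n + 1 \<longrightarrow>
           (\<forall>j\<in>{0..k}.
              realizes_value n \<epsilon> F (toss_right_on n {j + 1..k}) (move_left_on n {1..k})) \<and>
           (\<exists>j\<in>{0..k}. toss_right_on n {j + 1..k} = toss_right_on n {}))"
    if "k \<le> n" "2 * real k - real n - 1 < Q" "Q \<le> 2 * real k - real n + 1" for k
  proof -
    have "(2 * real k - real n - 1) * \<epsilon> \<le> F (n + 1) - F 0"
      "F (n + 1) - F 0 \<le> (2 * real k - real n + 1) * \<epsilon>"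
      unfolding diff using that \<open>\<epsilon> > 0\<close> by (intro mult_right_mono; simp)+
    note vals = forced_value [where F = F, OF \<open>\<epsilon> > 0\<close> \<open>k \<le> n\<close> this]
    have "\<exists>j\<in>{0..k}. toss_right_on n {j + 1..k} = toss_right_on n {}"
      by (rule bexI [of _ k]) simp_all
    moreover have "F (n + 1) - F 0 = (2 * real k - real n + 1) * \<epsilon>" if "Q = 2 * real k - real n + 1"
      using diff that by simp
    ultimately show ?thesis
      using vals(1) [unfolded forced_value_def] vals(2,3)
      by (intro conjI ballI impI) simp_all
  qed
  have b: ?b
    using forced [of n] by auto
  have c: ?c
  proof (intro ballI impI, goal_cases)
    case (1 k)
    then show ?case
      by (intro forced) auto
  qed
  show ?thesis
    by (rule conjI [OF exhaustive conjI [OF a conjI [OF b c]]])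
qed

end
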